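(* The following question has a negative answer: if $\mathcal{U}$ is a nonprincipal ultrafilter on $\omega$ and $H$ is a group such that every $h \in H$ lies in a homomorphic image within $H$ of $(\prod_{\omega}\mathbb{Z})/\mathcal{U}$, must $H$ be a homomorphic image of a nonprincipal ultraproduct $(\prod_{i \in \omega} G_i)/\mathcal{V}$? The direct sum $\bigoplus_{n \in \omega \setminus \{0\}} \mathbb{Z}/n\mathbb{Z}$, taken as $H$, gives a negative answer.
   Context: $\omega$ is the set of natural numbers. For an ultrafilter $\mathcal{V}$ on $\omega$ and a sequence $(G_i)_{i\in\omega}$ of (not necessarily abelian) groups, the ultraproduct $(\prod_{i\in\omega} G_i)/\mathcal{V}$ is the quotient of the direct product $\prod_{i\in\omega} G_i$ by the normal subgroup of all $(g_i)_{i\in\omega}$ with $\{i\in\omega : g_i = 1_{G_i}\}\in\mathcal{V}$; it is called nonprincipal if $\mathcal{V}$ is nonprincipal. $(\prod_{\omega}\mathbb{Z})/\mathcal{U}$ is the ultraproduct over $\mathcal{U}$ with every factor equal to $\mathbb{Z}$. "$h$ lies in a homomorphic image within $H$ of a group $K$" means that $h$ lies in the image of some group homomorphism $K \to H$; "$H$ is a homomorphic image of $K$" means that there is a surjective group homomorphism $K\to H$. A group $H$ gives a negative answer to the question if it satisfies the hypothesis of the question but is not a homomorphic image of any nonprincipal ultraproduct $(\prod_{i \in \omega} G_i)/\mathcal{V}$. *)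

theory Defs
  imports "HOL-Algebra.Algebra"
begin

text \<open>Ultrafilters are rendered through the library type of filters: a set \<open>A\<close> belongs to \<open>V\<close>
  iff \<open>eventually (\<lambda>i. i \<in> A) V\<close>. That type contains the improper filter \<open>bot\<close>, which has to
  be excluded.\<close>

definition ultrafilter :: "'i filter \<Rightarrow> bool" where
  "ultrafilter V \<longleftrightarrow>
     V \<noteq> bot \<and> (\<forall>P. eventually P V \<or> eventually (\<lambda>i. \<not> P i) V)"

definition nonprincipal_ultrafilter :: "'i filter \<Rightarrow> bool" where
  "nonprincipal_ultrafilter V \<longleftrightarrow> ultrafilter V \<and> (\<forall>i. V \<noteq> principal {i})"

definition ultraproduct_kernel ::
    "(nat \<Rightarrow> ('g, 'm) monoid_scheme) \<Rightarrow> nat filter \<Rightarrow> (nat \<Rightarrow> 'g) set" where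
  "ultraproduct_kernel G V =
     {g \<in> carrier (product_group UNIV G). eventually (\<lambda>i. g i = \<one>\<^bsub>G i\<^esub>) V}"

definition ultraproduct ::
    "(nat \<Rightarrow> ('g, 'm) monoid_scheme) \<Rightarrow> nat filter \<Rightarrow> (nat \<Rightarrow> 'g) set monoid" where
  "ultraproduct G V = product_group UNIV G Mod ultraproduct_kernel G V"

definition in_homomorphic_image_within ::
    "'h \<Rightarrow> ('h, 'n) monoid_scheme \<Rightarrow> ('k, 'm) monoid_scheme \<Rightarrow> bool" where
  "in_homomorphic_image_within h H K \<longleftrightarrow> (\<exists>f \<in> hom K H. h \<in> f ` carrier K)"

definition is_homomorphic_image_of ::
    "('h, 'n) monoid_scheme \<Rightarrow> ('k, 'm) monoid_scheme \<Rightarrow> bool" where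
  "is_homomorphic_image_of H K \<longleftrightarrow> (\<exists>f. f \<in> epi K H)"

definition question_hypothesis :: "nat filter \<Rightarrow> ('h, 'n) monoid_scheme \<Rightarrow> bool" where
  "question_hypothesis U H \<longleftrightarrow>
     group H \<and>
     (\<forall>h \<in> carrier H. in_homomorphic_image_within h H (ultraproduct (\<lambda>_. integer_group) U))"

definition sum_of_finite_cyclic_groups :: "(nat \<Rightarrow> int) monoid" where
  "sum_of_finite_cyclic_groups = sum_group (UNIV - {0}) integer_mod_group"

end

(* A nonprincipal ultraproduct solves every system x_k = a_k (x_(k+1))^2, k = 0, 1, 2, ...: in the
   i-th coordinate set x_k = 1 for k > i and recurse downwards, so that the k-th equation holds in
   all coordinates i >= k.  Homomorphic images inherit this property.  In the direct sum of the Z/n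
   take for a_k the generator of the summand Z/2^(k+1): then x_0 is congruent to
   a_0 + 2 a_1 + ... + 2^k a_k modulo 2^(k+1), so its component in Z/2^(k+1) is 2^k, which is
   nonzero for every k.  This contradicts finite support.

   In the positive direction, all elements of the direct sum have finite order, and the limit along
   U of the residues modulo m maps the ultrapower of Z onto Z/m. *)

theory Submission
  imports Defs
begin

section \<open>Ultrafilters\<close>

text \<open>Zorn's lemma yields a minimal proper filter below \<open>F\<close>. Minimality forces it
  to decide every predicate.\<close>

lemma ultrafilter_le:
  fixes F :: "'i filter"
  assumes "F \<noteq> bot"
  shows "\<exists>V. ultrafilter V \<and> V \<le> F"
proof -
  define A where "A = {G :: 'i filter. G \<noteq> bot \<and> G \<le> F}"
  have "\<exists>M\<in>A. \<forall>G\<in>A. G \<le> M \<longrightarrow> G = M"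
  proof (rule predicate_Zorn)
    \<comment> \<open>The order is reversed, so that a maximal element is a minimal proper filter
      and chains are bounded by infima.\<close>
    show "partial_order_on A (relation_of (\<lambda>x y. y \<le> x) A)"
      by (rule partial_order_on_relation_ofI) auto
  next
    fix C assume C: "C \<in> Chains (relation_of (\<lambda>x y :: 'i filter. y \<le> x) A)"
    show "\<exists>u\<in>A. \<forall>a\<in>C. u \<le> a"
    proof (cases "C = {}")
      case True
      then show ?thesis using assms by (auto simp: A_def)
    next
      case False
      have CA: "C \<subseteq> A" and lin: "\<And>x y. x \<in> C \<Longrightarrow> y \<in> C \<Longrightarrow> x \<le> y \<or> y \<le> x"
        using C by (auto simp: Chains_def relation_of_def)
      \<comment> \<open>A chain is a filter base: whatever holds eventually in \<open>Inf C\<close>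
        already does in some member. Hence \<open>Inf C\<close> is proper, as all members
        are.\<close>
      have base: "\<exists>x\<in>C. x \<le> inf G H" if "G \<in> C" "H \<in> C" for G H
        using lin[OF that] that by (auto intro: bexI[of _ G] bexI[of _ H])
      have "eventually P (Inf C) \<longleftrightarrow> (\<exists>b\<in>C. eventually P b)" for P
        by (rule eventually_Inf_base[OF False base])
      then have "Inf C \<noteq> bot"
        using CA unfolding trivial_limit_def A_def by blast
      moreover have "Inf C \<le> F"
        using False CA by (auto simp: A_def intro: Inf_lower2)
      ultimately show ?thesis
        by (auto simp: A_def intro: bexI[of _ "Inf C"] Inf_lower)
    qed
  qed
  then obtain V where V: "V \<noteq> bot" "V \<le> F"
      and max: "\<And>G. G \<noteq> bot \<Longrightarrow> G \<le> V \<Longrightarrow> G = V"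
    unfolding A_def by (blast intro: order_trans)
  have "eventually P V \<or> eventually (\<lambda>i. \<not> P i) V" for P
  \<comment> \<open>Either adding \<open>P\<close> to \<open>V\<close> destroys properness, so that
    \<open>V\<close> contains the negation, or minimality shows that \<open>V\<close> contained
    \<open>P\<close> already.\<close>
  proof (cases "inf V (principal {i. P i}) = bot")
    case True
    then have "eventually (\<lambda>i. \<not> P i) V"
      by (simp add: trivial_limit_def eventually_inf_principal)
    then show ?thesis ..
  next
    case False
    then have "V \<le> principal {i. P i}"
      using max[OF False] by (metis inf.cobounded1 inf.cobounded2)
    then show ?thesis by (simp add: le_principal)
  qed
  with V show ?thesis by (auto simp: ultrafilter_def)
qed

lemma nonprincipal_ultrafilter_exists: "\<exists>U :: nat filter. nonprincipal_ultrafilter U"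
proof -
  obtain U :: "nat filter" where U: "ultrafilter U" "U \<le> cofinite"
    using ultrafilter_le[of "cofinite :: nat filter"] by auto
  have "U \<noteq> principal {j}" for j
  proof
    assume "U = principal {j}"
    moreover have "eventually (\<lambda>i. i \<noteq> j) U"
      by (rule filter_leD[OF U(2)]) (simp add: eventually_cofinite)
    ultimately show False by (simp add: eventually_principal)
  qed
  with U show ?thesis unfolding nonprincipal_ultrafilter_def by blast
qed

text \<open>If \<open>V\<close> omitted the complement of a point \<open>j\<close>, it would contain
  \<open>{j}\<close> and be principal at \<open>j\<close>. A cofinite set is a finite intersection
  of such complements.\<close>

lemma nonprincipal_ultrafilter_le_cofinite:
  assumes "nonprincipal_ultrafilter V"
  shows "V \<le> cofinite"
proof (rule filter_leI)
  fix P :: "'a \<Rightarrow> bool" assume P: "eventually P cofinite"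
  have "eventually (\<lambda>i. i \<noteq> j) V" for j
  proof (rule ccontr)
    assume "\<not> eventually (\<lambda>i. i \<noteq> j) V"
    then have ev: "eventually (\<lambda>i. i = j) V"
      using assms unfolding nonprincipal_ultrafilter_def ultrafilter_def
      by (metis (mono_tags, lifting) eventually_mono)
    have "eventually Q V \<longleftrightarrow> Q j" for Q
    proof
      assume "eventually Q V"
      then have "eventually (\<lambda>i. Q j) V" using ev by eventually_elim simp
      then show "Q j"
        using assms by (auto simp: nonprincipal_ultrafilter_def ultrafilter_def)
    qed (use ev in \<open>auto elim: eventually_mono\<close>)
    then have "V = principal {j}" by (simp add: filter_eq_iff eventually_principal)
    then show False using assms by (simp add: nonprincipal_ultrafilter_def)
  qed
  then have "eventually (\<lambda>i. \<forall>j\<in>{j. \<not> P j}. i \<noteq> j) V"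
    using P by (intro eventually_ball_finite) (auto simp: eventually_cofinite)
  then show "eventually P V" by eventually_elim auto
qed

text \<open>Otherwise all the finitely many alternatives would fail simultaneously on a set of
  \<open>V\<close>. This is what gives limits of sequences with finitely many values.\<close>

lemma ultrafilter_eventually_bex_finite:
  assumes "ultrafilter V" "finite S" "eventually (\<lambda>i. \<exists>c\<in>S. P c i) V"
  shows "\<exists>c\<in>S. eventually (P c) V"
proof (rule ccontr)
  assume "\<not> ?thesis"
  then have "\<forall>c\<in>S. eventually (\<lambda>i. \<not> P c i) V"
    using assms(1) unfolding ultrafilter_def by blast
  then have "eventually (\<lambda>i. \<forall>c\<in>S. \<not> P c i) V"
    by (intro eventually_ball_finite assms(2))
  with assms(3) have "eventually (\<lambda>i. False) V" by eventually_elim auto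
  then show False using assms(1) by (simp add: ultrafilter_def)
qed

section \<open>Ultraproducts\<close>

lemma ultraproduct_kernel_normal:
  assumes G: "\<And>i. group (G i)"
  shows "ultraproduct_kernel G V \<lhd> product_group UNIV G"
proof -
  interpret P: group "product_group UNIV G" using G by simp
  have m[simp]: "monoid (G i)" for i using G by (simp add: group.is_monoid)
  show ?thesis
  proof (rule P.normal_invI)
    show "subgroup (ultraproduct_kernel G V) (product_group UNIV G)"
    proof (rule P.subgroupI)
      show "ultraproduct_kernel G V \<noteq> {}"
        using P.one_closed by (force simp: ultraproduct_kernel_def)
    next
      fix a assume a: "a \<in> ultraproduct_kernel G V"
      then have "inv\<^bsub>product_group UNIV G\<^esub> a = (\<lambda>i. inv\<^bsub>G i\<^esub> a i)"
        using G by (simp add: ultraproduct_kernel_def restrict_def)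
      moreover have "eventually (\<lambda>i. inv\<^bsub>G i\<^esub> a i = \<one>\<^bsub>G i\<^esub>) V"
        using a unfolding ultraproduct_kernel_def
        by (auto elim!: eventually_mono simp: monoid.inv_one)
      ultimately show "inv\<^bsub>product_group UNIV G\<^esub> a \<in> ultraproduct_kernel G V"
        using P.inv_closed[of a] a by (auto simp: ultraproduct_kernel_def)
    next
      fix a b assume ab: "a \<in> ultraproduct_kernel G V" "b \<in> ultraproduct_kernel G V"
      then have "eventually (\<lambda>i. a i = \<one>\<^bsub>G i\<^esub>) V" "eventually (\<lambda>i. b i = \<one>\<^bsub>G i\<^esub>) V"
        by (auto simp: ultraproduct_kernel_def)
      then have "eventually (\<lambda>i. a i \<otimes>\<^bsub>G i\<^esub> b i = \<one>\<^bsub>G i\<^esub>) V"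
        by eventually_elim simp
      then show "a \<otimes>\<^bsub>product_group UNIV G\<^esub> b \<in> ultraproduct_kernel G V"
        using P.m_closed[of a b] ab by (auto simp: ultraproduct_kernel_def)
    qed (auto simp: ultraproduct_kernel_def)
  next
    fix x h assume x: "x \<in> carrier (product_group UNIV G)" and h: "h \<in> ultraproduct_kernel G V"
    then have "eventually (\<lambda>i. h i = \<one>\<^bsub>G i\<^esub>) V"
      by (auto simp: ultraproduct_kernel_def)
    then have "eventually (\<lambda>i. x i \<otimes>\<^bsub>G i\<^esub> h i \<otimes>\<^bsub>G i\<^esub> inv\<^bsub>G i\<^esub> x i = \<one>\<^bsub>G i\<^esub>) V"
      using x G by (auto elim!: eventually_mono simp: PiE_iff group.r_inv)
    moreover have "x \<otimes>\<^bsub>product_group UNIV G\<^esub> h \<otimes>\<^bsub>product_group UNIV G\<^esub> inv\<^bsub>product_group UNIV G\<^esub> x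
        = (\<lambda>i. x i \<otimes>\<^bsub>G i\<^esub> h i \<otimes>\<^bsub>G i\<^esub> inv\<^bsub>G i\<^esub> x i)"
      using x G by (simp add: restrict_def)
    moreover have "x \<otimes>\<^bsub>product_group UNIV G\<^esub> h \<otimes>\<^bsub>product_group UNIV G\<^esub> inv\<^bsub>product_group UNIV G\<^esub> x
        \<in> carrier (product_group UNIV G)"
      using x h by (intro P.m_closed P.inv_closed) (auto simp: ultraproduct_kernel_def)
    ultimately show "x \<otimes>\<^bsub>product_group UNIV G\<^esub> h \<otimes>\<^bsub>product_group UNIV G\<^esub> inv\<^bsub>product_group UNIV G\<^esub> x
        \<in> ultraproduct_kernel G V"
      by (simp add: ultraproduct_kernel_def)
  qed
qed

text \<open>The quotient of \<open>y\<close> by \<open>x\<close> is trivial wherever they agree, so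
  it lies in the kernel. Equations in the ultraproduct can thus be checked on a set of coordinates
  in \<open>V\<close>.\<close>

lemma ultraproduct_coset_eqI:
  assumes G: "\<And>i. group (G i)"
    and x: "x \<in> carrier (product_group UNIV G)" and y: "y \<in> carrier (product_group UNIV G)"
    and ev: "eventually (\<lambda>i. x i = y i) V"
  shows "ultraproduct_kernel G V #>\<^bsub>product_group UNIV G\<^esub> x
       = ultraproduct_kernel G V #>\<^bsub>product_group UNIV G\<^esub> y"
proof -
  interpret P: group "product_group UNIV G" using G by simp
  have sub: "subgroup (ultraproduct_kernel G V) (product_group UNIV G)"
    by (intro normal_imp_subgroup ultraproduct_kernel_normal G)
  have "eventually (\<lambda>i. y i \<otimes>\<^bsub>G i\<^esub> inv\<^bsub>G i\<^esub> x i = \<one>\<^bsub>G i\<^esub>) V"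
    using ev y G by (auto elim!: eventually_mono simp: PiE_iff group.r_inv)
  moreover have "y \<otimes>\<^bsub>product_group UNIV G\<^esub> inv\<^bsub>product_group UNIV G\<^esub> x
      = (\<lambda>i. y i \<otimes>\<^bsub>G i\<^esub> inv\<^bsub>G i\<^esub> x i)"
    using x G by (simp add: restrict_def)
  moreover have "y \<otimes>\<^bsub>product_group UNIV G\<^esub> inv\<^bsub>product_group UNIV G\<^esub> x
      \<in> carrier (product_group UNIV G)"
    using x y by (intro P.m_closed P.inv_closed)
  ultimately have "y \<otimes>\<^bsub>product_group UNIV G\<^esub> inv\<^bsub>product_group UNIV G\<^esub> x
      \<in> ultraproduct_kernel G V"
    by (simp add: ultraproduct_kernel_def)
  then have "y \<in> ultraproduct_kernel G V #>\<^bsub>product_group UNIV G\<^esub> x"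
    by (rule subgroup.rcos_module_rev[OF sub P.is_group x y])
  then show ?thesis by (rule P.repr_independence[OF _ x sub])
qed

section \<open>Recursive square equations in ultraproducts\<close>

text \<open>\<open>nested_squares M a d k\<close> is the value of the \<open>k\<close>-th unknown in the system
  \<open>x k = a k \<otimes> (x (Suc k))\<^sup>2\<close> when the unknowns from index \<open>k + d\<close> on are set to \<open>\<one>\<close>.\<close>

primrec nested_squares :: "('g, 'm) monoid_scheme \<Rightarrow> (nat \<Rightarrow> 'g) \<Rightarrow> nat \<Rightarrow> nat \<Rightarrow> 'g" where
  "nested_squares M a 0 k = \<one>\<^bsub>M\<^esub>"
| "nested_squares M a (Suc d) k =
     a k \<otimes>\<^bsub>M\<^esub> (nested_squares M a d (Suc k) \<otimes>\<^bsub>M\<^esub> nested_squares M a d (Suc k))"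

lemma (in monoid) nested_squares_closed:
  assumes "\<And>k. a k \<in> carrier G"
  shows "nested_squares G a d k \<in> carrier G"
  by (induction d arbitrary: k) (use assms in auto)

lemma ultraproduct_solves_squares:
  assumes V: "nonprincipal_ultrafilter V" and G: "\<And>i. group (G i)"
    and a: "\<And>k. a k \<in> carrier (ultraproduct G V)"
  obtains x where "\<And>k. x k \<in> carrier (ultraproduct G V)"
    and "\<And>k. x k = a k \<otimes>\<^bsub>ultraproduct G V\<^esub> (x (Suc k) \<otimes>\<^bsub>ultraproduct G V\<^esub> x (Suc k))"
proof -
  let ?P = "product_group UNIV G" and ?N = "ultraproduct_kernel G V"
  let ?q = "\<lambda>x. ?N #>\<^bsub>?P\<^esub> x"
  interpret P: group ?P using G by simp
  interpret N: normal ?N ?P by (rule ultraproduct_kernel_normal[OF G])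
  have q: "?q \<in> hom ?P (ultraproduct G V)"
    unfolding ultraproduct_def by (rule N.r_coset_hom_Mod)
  have "\<forall>k. \<exists>g. g \<in> carrier ?P \<and> a k = ?q g"
    using a unfolding ultraproduct_def carrier_FactGroup by blast
  then obtain g where g: "\<And>k. g k \<in> carrier ?P" and ag: "\<And>k. a k = ?q (g k)"
    by metis
  have gi: "g k i \<in> carrier (G i)" for k i using g[of k] by (simp add: PiE_iff)
  \<comment> \<open>The depth \<open>Suc i - k\<close> makes the unknowns with index above
    \<open>i\<close> equal to 1 in coordinate \<open>i\<close>; natural subtraction gives depth 0
    there.\<close>
  define x where "x k = (\<lambda>i. nested_squares (G i) (\<lambda>k. g k i) (Suc i - k) k)" for k
  have x: "x k \<in> carrier ?P" for k
    using G gi by (auto simp: x_def group.is_monoid intro!: monoid.nested_squares_closed)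
  have q_eq: "?q (x k) = ?q (g k \<otimes>\<^bsub>?P\<^esub> (x (Suc k) \<otimes>\<^bsub>?P\<^esub> x (Suc k)))" for k
  proof (rule ultraproduct_coset_eqI[OF G])
    \<comment> \<open>For \<open>k \<le> i\<close> the depth \<open>Suc i - k\<close> is the
      successor of \<open>Suc i - Suc k\<close>, so one unfolding of the recursion is the required
      equation. Only finitely many coordinates are lost.\<close>
    have "eventually (\<lambda>i. k \<le> i) V"
      using nonprincipal_ultrafilter_le_cofinite[OF V]
      by (rule filter_leD) (simp add: cofinite_eq_sequentially eventually_ge_at_top)
    then show "eventually (\<lambda>i. x k i = (g k \<otimes>\<^bsub>?P\<^esub> (x (Suc k) \<otimes>\<^bsub>?P\<^esub> x (Suc k))) i) V"
      by eventually_elim (simp add: x_def Suc_diff_le)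
  qed (intro x P.m_closed g)+
  have "?q (x k) = a k \<otimes>\<^bsub>ultraproduct G V\<^esub>
      (?q (x (Suc k)) \<otimes>\<^bsub>ultraproduct G V\<^esub> ?q (x (Suc k)))" for k
    unfolding q_eq[of k] ag by (simp only: hom_mult[OF q] P.m_closed x g)
  moreover have "?q (x k) \<in> carrier (ultraproduct G V)" for k
    using x by (rule hom_in_carrier[OF q])
  ultimately show thesis by (rule that[rotated])
qed

section \<open>Torsion elements as images of the ultrapower of the integers\<close>

text \<open>Raising \<open>h\<close> to the limit along \<open>U\<close> of the residues modulo
  \<open>m\<close> is a homomorphism on integer sequences that kills the kernel of the
  ultrapower.\<close>

lemma finite_order_in_homomorphic_image_within:
  assumes U: "ultrafilter U" and H: "group H" and h: "h \<in> carrier H"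
    and m: "m > 0" and hm: "h [^]\<^bsub>H\<^esub> (m :: nat) = \<one>\<^bsub>H\<^esub>"
  shows "in_homomorphic_image_within h H (ultraproduct (\<lambda>_. integer_group) U)"
proof -
  let ?P = "product_group UNIV (\<lambda>_ :: nat. integer_group)"
    and ?N = "ultraproduct_kernel (\<lambda>_. integer_group) U"
  interpret H: group H by (rule H)
  interpret P: group ?P by simp
  interpret N: normal ?N ?P by (rule ultraproduct_kernel_normal) simp
  define lim where "lim x = (SOME c. eventually (\<lambda>i. x i mod int m = c) U)" for x
  have ex: "\<exists>c. eventually (\<lambda>i. x i mod int m = c) U" for x
    using ultrafilter_eventually_bex_finite[OF U, of "{0..<int m}" "\<lambda>c i. x i mod int m = c"] m
    by auto
  then have lim: "eventually (\<lambda>i. x i mod int m = lim x) U" for x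
    unfolding lim_def by (rule someI_ex)
  have lim_eq: "lim x = c" if "eventually (\<lambda>i. x i mod int m = c) U" for x c
  proof -
    have "eventually (\<lambda>i. lim x = c) U" using that lim[of x] by eventually_elim simp
    then show ?thesis using U by (simp add: ultrafilter_def)
  qed
  \<comment> \<open>Residues add only modulo \<open>m\<close>, which is harmless in the exponent
    because the order of \<open>h\<close> divides \<open>m\<close>.\<close>
  have pow_mod: "h [^]\<^bsub>H\<^esub> (c mod int m) = h [^]\<^bsub>H\<^esub> c" for c :: int
  proof -
    have "h [^]\<^bsub>H\<^esub> (int m * (c div int m)) = \<one>\<^bsub>H\<^esub>"
      using h hm by (simp add: H.int_pow_pow[symmetric] int_pow_int)
    then show ?thesis
      using h H.int_pow_mult[OF h, of "int m * (c div int m)" "c mod int m"] by simp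
  qed
  define \<phi> where "\<phi> x = h [^]\<^bsub>H\<^esub> lim x" for x
  have "\<phi> (x \<otimes>\<^bsub>?P\<^esub> y) = \<phi> x \<otimes>\<^bsub>H\<^esub> \<phi> y" for x y
  proof -
    have "eventually (\<lambda>i. (x i + y i) mod int m = (lim x + lim y) mod int m) U"
      using lim[of x] lim[of y] by eventually_elim (metis mod_add_eq)
    then have "lim (\<lambda>i. x i + y i) = (lim x + lim y) mod int m" by (rule lim_eq)
    then show ?thesis using h by (simp add: \<phi>_def pow_mod H.int_pow_mult restrict_def)
  qed
  then have "\<phi> \<in> hom ?P H" using h by (intro homI) (auto simp: \<phi>_def)
  then interpret \<phi>: group_hom ?P H \<phi> by unfold_locales
  have "?N \<subseteq> kernel ?P H \<phi>"
  proof
    fix x assume x: "x \<in> ?N"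
    then have "eventually (\<lambda>i. x i mod int m = 0) U"
      unfolding ultraproduct_kernel_def by (auto elim!: eventually_mono)
    then have "lim x = 0" by (rule lim_eq)
    with x show "x \<in> kernel ?P H \<phi>" by (simp add: kernel_def \<phi>_def ultraproduct_kernel_def)
  qed
  then obtain f where f: "f \<in> hom (?P Mod ?N) H"
      and f\<phi>: "\<And>x. x \<in> carrier ?P \<Longrightarrow> f (?N #>\<^bsub>?P\<^esub> x) = \<phi> x"
    using \<phi>.FactGroup_universal_kernel[OF N.normal_axioms] by blast
  \<comment> \<open>The constant sequence 1 is sent to \<open>h\<close>. Its limit is written
    \<open>1 mod int m\<close> to cover \<open>m = 1\<close>.\<close>
  have one: "(\<lambda>_. 1) \<in> carrier ?P" by simp
  have "lim (\<lambda>_. 1) = 1 mod int m" by (rule lim_eq) simp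
  then have "\<phi> (\<lambda>_. 1) = h" using h by (simp add: \<phi>_def pow_mod)
  with f\<phi>[OF one] have "h = f (?N #>\<^bsub>?P\<^esub> (\<lambda>_. 1))" by simp
  moreover have "?N #>\<^bsub>?P\<^esub> (\<lambda>_. 1) \<in> carrier (?P Mod ?N)"
    using one unfolding carrier_FactGroup by (rule imageI)
  ultimately show ?thesis
    using f unfolding in_homomorphic_image_within_def ultraproduct_def by blast
qed

section \<open>The direct sum of the finite cyclic groups\<close>

lemma group_sum_of_finite_cyclic_groups: "group sum_of_finite_cyclic_groups"
  by (simp add: sum_of_finite_cyclic_groups_def)

lemma sum_of_finite_cyclic_groups_torsion:
  assumes h: "h \<in> carrier sum_of_finite_cyclic_groups"
  obtains m :: nat where "m > 0"
    and "h [^]\<^bsub>sum_of_finite_cyclic_groups\<^esub> m = \<one>\<^bsub>sum_of_finite_cyclic_groups\<^esub>"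
proof -
  define S where "S = {n \<in> UNIV - {0 :: nat}. h n \<noteq> 0}"
  have fin: "finite S" and nz: "0 \<notin> S"
    using h by (auto simp: sum_of_finite_cyclic_groups_def carrier_sum_group S_def)
  have pow: "h [^]\<^bsub>sum_of_finite_cyclic_groups\<^esub> (k :: nat) = (\<lambda>n\<in>UNIV - {0}. int k * h n mod int n)" for k
    by (induction k)
      (auto simp: sum_of_finite_cyclic_groups_def fun_eq_iff mod_simps algebra_simps)
  show thesis
  proof
    \<comment> \<open>The product of the indices in the support annihilates \<open>h\<close>: each
      such index \<open>n\<close> divides it, and the other components are zero.\<close>
    have "\<Prod>S \<noteq> 0" using fin nz by simp
    then show "\<Prod>S > 0" by simp
    have "int (\<Prod>S) * h n mod int n = 0" if "n \<noteq> 0" for n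
    proof (cases "n \<in> S")
      case True
      then have "int n dvd int (\<Prod>S)"
        using dvd_prodI[OF fin, of n "\<lambda>n. n"] by (simp only: int_dvd_int_iff)
      then show ?thesis by (metis dvd_imp_mod_0 dvd_mult2)
    qed (use that in \<open>simp add: S_def\<close>)
    then show "h [^]\<^bsub>sum_of_finite_cyclic_groups\<^esub> \<Prod>S = \<one>\<^bsub>sum_of_finite_cyclic_groups\<^esub>"
      unfolding pow by (simp add: sum_of_finite_cyclic_groups_def fun_eq_iff)
  qed
qed

lemma sum_of_finite_cyclic_groups_not_image:
  assumes V: "nonprincipal_ultrafilter V" and G: "\<And>i. group (G i)"
  shows "\<not> is_homomorphic_image_of sum_of_finite_cyclic_groups (ultraproduct G V)"
proof
  let ?H = sum_of_finite_cyclic_groups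
  assume "is_homomorphic_image_of ?H (ultraproduct G V)"
  then obtain f where f: "f \<in> hom (ultraproduct G V) ?H"
      and surj: "f ` carrier (ultraproduct G V) = carrier ?H"
    unfolding is_homomorphic_image_of_def epi_def by blast
  \<comment> \<open>The generator of the summand of order \<open>2 ^ Suc k\<close>. The exponent
    starts at 1, so that 1 is a valid nonzero residue.\<close>
  define e where "e k = (\<lambda>n\<in>UNIV - {0 :: nat}. if n = 2 ^ Suc k then 1 else 0 :: int)" for k
  have "e k \<in> carrier ?H" for k
  proof -
    have "finite {n \<in> UNIV - {0}. e k n \<noteq> 0}"
      by (rule finite_subset[of _ "{2 ^ Suc k}"]) (auto simp: e_def)
    moreover have "e k n \<in> carrier (integer_mod_group n)" if "n \<noteq> 0" for n
      using that one_less_power[of "2 :: int" "Suc k"]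
      by (auto simp: carrier_integer_mod_group e_def)
    ultimately show ?thesis
      by (auto simp: sum_of_finite_cyclic_groups_def carrier_sum_group e_def)
  qed
  then have "\<forall>k. \<exists>a \<in> carrier (ultraproduct G V). e k = f a"
    unfolding surj[symmetric] by blast
  then obtain a where a: "\<And>k. a k \<in> carrier (ultraproduct G V)" and ea: "\<And>k. e k = f (a k)"
    by metis
  obtain x where x: "\<And>k. x k \<in> carrier (ultraproduct G V)"
      and x_eq: "\<And>k. x k = a k \<otimes>\<^bsub>ultraproduct G V\<^esub> (x (Suc k) \<otimes>\<^bsub>ultraproduct G V\<^esub> x (Suc k))"
    by (rule ultraproduct_solves_squares[where a = a, OF V G a]) (rule that)
  have "group (ultraproduct G V)"
    unfolding ultraproduct_def by (intro normal.factorgroup_is_group ultraproduct_kernel_normal G)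
  then interpret K: group "ultraproduct G V" .
  define y where "y k = f (x k)" for k
  have y: "y k \<in> carrier ?H" for k
    unfolding y_def using x by (rule hom_in_carrier[OF f])
  have "y k = e k \<otimes>\<^bsub>?H\<^esub> (y (Suc k) \<otimes>\<^bsub>?H\<^esub> y (Suc k))" for k
    unfolding y_def ea by (subst x_eq) (simp add: hom_mult[OF f] x a)
  note y_eq = fun_cong[OF this]
  \<comment> \<open>In additive notation and a fixed component, squaring becomes doubling;
    \<open>sum\<close> below iterates this \<open>j\<close> times.\<close>
  have cong: "y k n mod int n = (e k n + 2 * y (Suc k) n) mod int n" if "n \<noteq> 0" for k n
    using y_eq[of k n] that by (simp add: sum_of_finite_cyclic_groups_def mod_simps)
  have sum: "y 0 n mod int n = ((\<Sum>k<j. 2 ^ k * e k n) + 2 ^ j * y j n) mod int n"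
    if "n \<noteq> 0" for n j
  proof (induction j)
    case (Suc j)
    have "((\<Sum>k<j. 2 ^ k * e k n) + 2 ^ j * y j n) mod int n
        = ((\<Sum>k<j. 2 ^ k * e k n) + 2 ^ j * (e j n + 2 * y (Suc j) n)) mod int n"
      by (intro mod_add_cong mod_mult_cong refl cong that)
    with Suc.IH show ?case by (simp add: algebra_simps)
  qed simp
  have "y 0 (2 ^ Suc j) \<noteq> 0" for j
  proof
    let ?n = "2 ^ Suc j :: nat"
    assume "y 0 ?n = 0"
    \<comment> \<open>In component \<open>2 ^ Suc j\<close> only \<open>e j\<close> is nonzero.
      After \<open>Suc j\<close> iterations the remainder has coefficient \<open>2 ^ Suc j\<close>,
      the modulus itself, and vanishes, leaving \<open>2 ^ j\<close>.\<close>
    moreover have "(\<Sum>k<Suc j. 2 ^ k * e k ?n) = (2 ^ j :: int)"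
      by (simp add: e_def)
    ultimately have "(2 ^ j + 2 ^ Suc j * y (Suc j) ?n) mod int ?n = 0"
      using sum[of ?n "Suc j"] by simp
    then have "(2 ^ j :: int) mod 2 ^ Suc j = 0" by simp
    then show False by simp
  qed
  then have "range (\<lambda>j. 2 ^ Suc j) \<subseteq> {n \<in> UNIV - {0}. y 0 n \<noteq> 0}" by auto
  moreover have "finite {n \<in> UNIV - {0}. y 0 n \<noteq> 0}"
    using y[of 0] by (simp add: sum_of_finite_cyclic_groups_def carrier_sum_group)
  moreover have "infinite (range (\<lambda>j. 2 ^ Suc j :: nat))"
    by (rule range_inj_infinite) (auto simp: inj_def)
  ultimately show False by (metis finite_subset)
qed

text \<open>The first conjunct keeps the second from being vacuous. The factors share an arbitrary
  element type \<open>'g\<close> but may have different carriers and operations.\<close>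

theorem mainTheorem3:
  shows "(\<exists>U :: nat filter. nonprincipal_ultrafilter U) \<and>
    (\<forall>U :: nat filter. nonprincipal_ultrafilter U \<longrightarrow>
       question_hypothesis U sum_of_finite_cyclic_groups) \<and>
    \<not> (\<exists>(V :: nat filter) (G :: nat \<Rightarrow> 'g monoid).
       nonprincipal_ultrafilter V \<and> (\<forall>i. group (G i)) \<and>
       is_homomorphic_image_of sum_of_finite_cyclic_groups (ultraproduct G V))"
proof (intro conjI allI impI)
  show "\<exists>U :: nat filter. nonprincipal_ultrafilter U"
    by (rule nonprincipal_ultrafilter_exists)
next
  fix U :: "nat filter" assume "nonprincipal_ultrafilter U"
  then have "ultrafilter U" by (simp add: nonprincipal_ultrafilter_def)
  then show "question_hypothesis U sum_of_finite_cyclic_groups"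
    unfolding question_hypothesis_def
    by (metis finite_order_in_homomorphic_image_within group_sum_of_finite_cyclic_groups
        sum_of_finite_cyclic_groups_torsion)
next
  show "\<not> (\<exists>(V :: nat filter) (G :: nat \<Rightarrow> 'g monoid).
       nonprincipal_ultrafilter V \<and> (\<forall>i. group (G i)) \<and>
       is_homomorphic_image_of sum_of_finite_cyclic_groups (ultraproduct G V))"
    using sum_of_finite_cyclic_groups_not_image by blast
qed

end
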